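(* Let $P$ be a noncrossing partition of $\{1,\dots,n\}$ and $\gamma=(A,B,C,D)$ a four-coloring given by integers $1\le i<j\le k<\ell\le n$. Then $\Phi(P,\gamma)$ is a permutation of genus $0$ or $1$. It has genus $1$ if and only if at least one of the following holds: (1) some part of $P$ meets at least three of the sets $A,B,C,D$; (2) there are two parts $P_q,P_r$ of $P$ and three distinct colors $X,Y,Z\in\{A,B,C,D\}$ such that $P_q\cap X\ne\emptyset$, $P_q\cap Y\neq\emptyset$, $P_q\subseteq X\cup Y$, and $P_r\cap X\ne\emptyset$, $P_r\cap Z\ne\emptyset$, $P_r\subseteq X\cup Z$.
   Context: Permutations are composed right to left; $\zeta_n=(1,2,\dots,n)$; $z(\pi)$ is the number of cycles of $\pi$; the genus $g(\alpha)$ of $\alpha\in S_n$ is defined by $n+1-2g(\alpha)=z(\alpha)+z(\alpha^{-1}\zeta_n)$. A partition $P$ of $\{1,\dots,n\}$ is identified with the permutation $\beta_P$ whose cycles are the blocks of $P$ written in increasing order; it is noncrossing if there are no $a<b<a'<b'$ with $a,a'$ in one block and $b,b'$ in a different block. A four-coloring $\gamma=(A,B,C,D)$ of $\{1,\dots,n\}$ is given by integers $1\le i<j\le k<\ell\le n$: $A=\{\ell+1,\dots,n\}\cup\{1,\dots,i\}$, $B=\{i+1,\dots,j\}$, $C=\{j+1,\dots,k\}$ (empty if $j=k$), $D=\{k+1,\dots,\ell\}$. Define $\phi\in S_n$ by $\phi(x)=x$ for $x\in A$, $\phi(x)=x+\ell-j$ for $x\in B$, $\phi(x)=x+i+\ell-j-k$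 for $x\in C$, $\phi(x)=x+i-k$ for $x\in D$ (this relabels so that $A$ keeps its labels and then the points of $D$, then $C$, then $B$ receive the next labels in order). Then $\Phi(P,\gamma)=\phi\,\beta_P\,\phi^{-1}$. *)

theory Defs
  imports "HOL-Combinatorics.Combinatorics" "HOL-Library.Disjoint_Sets"
begin

text \<open>
  Elements of \<open>S\<^sub>n\<close> are functions \<open>nat \<Rightarrow> nat\<close> with \<open>p permutes {1..n}\<close>, hence the identity
  outside \<open>{1..n}\<close>; the product is function composition, that is, right to left.
\<close>

definition zeta :: "nat \<Rightarrow> nat \<Rightarrow> nat" where
  "zeta n = cycle_of_list [1..<Suc n]"

text \<open>Fixed points in \<open>{1..n}\<close> count as cycles of length one.\<close>

definition num_cycles :: "nat \<Rightarrow> (nat \<Rightarrow> nat) \<Rightarrow> nat" where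
  "num_cycles n p = card (orbit p ` {1..n})"

text \<open>
  The genus is the solution \<open>g\<close> of \<open>n + 1 - 2 g = z(p) + z(p\<^sup>-\<^sup>1 \<zeta>\<^sub>n)\<close>. It is taken in the
  rationals, so that neither the subtraction nor the division by two is truncated.
\<close>

definition genus :: "nat \<Rightarrow> (nat \<Rightarrow> nat) \<Rightarrow> rat" where
  "genus n p = (of_nat n + 1 - of_nat (num_cycles n p)
                 - of_nat (num_cycles n (inv p \<circ> zeta n))) / 2"

definition noncrossing :: "nat set set \<Rightarrow> bool" where
  "noncrossing P \<longleftrightarrow>
     \<not> (\<exists>p\<in>P. \<exists>q\<in>P. p \<noteq> q \<and>
          (\<exists>a b a' b'. a < b \<and> b < a' \<and> a' < b' \<and> a \<in> p \<and> a' \<in> p \<and> b \<in> q \<and> b' \<in> q))"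

definition block_perm :: "nat set set \<Rightarrow> nat \<Rightarrow> nat" where
  "block_perm P x =
     (if x \<in> \<Union>P then cycle_of_list (sorted_list_of_set (THE p. p \<in> P \<and> x \<in> p)) x else x)"

text \<open>
  The colors are labels, distinct from the sets they denote; \<open>color_class n i j k l\<close> maps each
  label to its set, for \<open>1 \<le> i < j \<le> k < l \<le> n\<close>.
\<close>

datatype color = ColA | ColB | ColC | ColD

fun color_class :: "nat \<Rightarrow> nat \<Rightarrow> nat \<Rightarrow> nat \<Rightarrow> nat \<Rightarrow> color \<Rightarrow> nat set" where
  "color_class n i j k l ColA = {l+1..n} \<union> {1..i}"
| "color_class n i j k l ColB = {i+1..j}"
| "color_class n i j k l ColC = {j+1..k}"
| "color_class n i j k l ColD = {k+1..l}"

text \<open>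
  The additions come before the subtractions, so under \<open>1 \<le> i < j \<le> k < l \<le> n\<close> no natural-number
  subtraction truncates. The last case covers color \<open>A\<close> and all points outside \<open>{1..n}\<close>.
\<close>

definition relabel :: "nat \<Rightarrow> nat \<Rightarrow> nat \<Rightarrow> nat \<Rightarrow> nat \<Rightarrow> nat \<Rightarrow> nat" where
  "relabel n i j k l x =
     (if x \<in> color_class n i j k l ColB then x + l - j
      else if x \<in> color_class n i j k l ColC then x + i + l - j - k
      else if x \<in> color_class n i j k l ColD then x + i - k
      else x)"

definition Phi :: "nat \<Rightarrow> nat set set \<Rightarrow> nat \<Rightarrow> nat \<Rightarrow> nat \<Rightarrow> nat \<Rightarrow> nat \<Rightarrow> nat" where
  "Phi n P i j k l = relabel n i j k l \<circ> block_perm P \<circ> inv (relabel n i j k l)"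

end

theory Submission
  imports Defs
begin

text \<open>
  Write \<open>\<beta>\<close> for the block permutation of \<open>P\<close> and \<open>K = \<beta>\<^sup>-\<^sup>1 \<zeta>\<^sub>n\<close> for its Kreweras complement. Conjugation
  by \<open>\<phi>\<close> turns \<open>\<Phi>(P, \<gamma>)\<^sup>-\<^sup>1 \<zeta>\<^sub>n\<close> into \<open>K (i k) (j l)\<close>, and \<open>\<beta>\<close> itself has genus 0. Each transposition
  joins two cycles or cuts one, so the genus depends only on which of \<open>i, j, k, l\<close> share a cycle
  of \<open>K\<close>. For \<open>a \<le> b\<close> this happens if and only if no block of \<open>P\<close> meets both \<open>{a+1..b}\<close> and its
  complement. Cutting twice is impossible: if \<open>i\<close> and \<open>k\<close> share a cycle of \<open>K\<close>, then \<open>{i+1..k}\<close> is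
  invariant under \<open>K (i k)\<close> and separates \<open>j\<close> from \<open>l\<close>. Hence the genus is 0 or 1, and
  it is 1 exactly when both transpositions join. Since \<open>i, j, k, l\<close> are the boundaries of the color
  classes, this is a condition on the sets of colors met by the blocks; by noncrossingness
  no two blocks meet \<open>A, C\<close> and \<open>B, D\<close> respectively.
\<close>

subsection \<open>Cycle counts\<close>

lemma orbit_self: "f permutes S \<Longrightarrow> finite S \<Longrightarrow> x \<in> orbit f x"
  by (rule permutation_self_in_orbit) (auto simp: permutation_permutes)

lemma orbit_sym: "f permutes S \<Longrightarrow> finite S \<Longrightarrow> y \<in> orbit f x \<Longrightarrow> x \<in> orbit f y"
  by (rule orbit_swap[OF orbit_self])

lemma orbit_eq: "f permutes S \<Longrightarrow> finite S \<Longrightarrow> y \<in> orbit f x \<Longrightarrow> orbit f y = orbit f x"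
  by (rule orbit_cyclic_eq3[OF cyclic_on_orbit])

lemma orbit_subset_closed:
  assumes "x \<in> T" "\<And>y. y \<in> T \<Longrightarrow> f y \<in> T"
  shows "orbit f x \<subseteq> T"
proof
  fix y assume "y \<in> orbit f x"
  then show "y \<in> T" by induct (auto simp: assms)
qed

text \<open>Choosing one element from each cycle makes the cycles correspond to the chosen elements.
  It is used with \<open>sel\<close> as \<open>Max\<close> for the Kreweras complement and as
  \<open>Min\<close> for the blocks.\<close>

lemma num_cycles_representatives:
  assumes f: "f permutes {1..n}" and sel: "\<And>x. x \<in> {1..n} \<Longrightarrow> sel (orbit f x) \<in> orbit f x"
  shows "num_cycles n f = card {x \<in> {1..n}. sel (orbit f x) = x}"
proof -
  have sub: "orbit f x \<subseteq> {1..n}" if "x \<in> {1..n}" for x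
    using f that by (rule permutes_orbit_subset)
  have eq: "orbit f (sel (orbit f x)) = orbit f x" if "x \<in> {1..n}" for x
    using orbit_eq[OF f _ sel[OF that]] by simp
  have inj: "inj_on sel (orbit f ` {1..n})"
  proof (rule inj_onI)
    fix s t assume "s \<in> orbit f ` {1..n}" "t \<in> orbit f ` {1..n}" "sel s = sel t"
    then show "s = t" using eq by (smt (verit) imageE)
  qed
  have "sel ` orbit f ` {1..n} = {x \<in> {1..n}. sel (orbit f x) = x}"
  proof (intro equalityI subsetI)
    fix y assume "y \<in> sel ` orbit f ` {1..n}"
    then obtain x where x: "x \<in> {1..n}" "y = sel (orbit f x)" by auto
    then show "y \<in> {x \<in> {1..n}. sel (orbit f x) = x}" using eq sel sub by fastforce
  next
    fix y assume "y \<in> {x \<in> {1..n}. sel (orbit f x) = x}"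
    then have "y \<in> {1..n}" "y = sel (orbit f y)" by auto
    then show "y \<in> sel ` orbit f ` {1..n}" by blast
  qed
  with card_image[OF inj] show ?thesis unfolding num_cycles_def by simp
qed

text \<open>The bijection \<open>h\<close> carries the orbits of \<open>f\<close> onto those of
  \<open>g\<close>. The pointwise form of the conjugacy avoids \<open>inv h\<close>.\<close>

lemma num_cycles_conjugate:
  assumes f: "f permutes {1..n}" and h: "h permutes {1..n}"
    and conj: "\<And>x. g (h x) = h (f x)"
  shows "num_cycles n g = num_cycles n f"
proof -
  have img: "h ` orbit f x = orbit g (h x)" for x
    using orbit_inverse[of x f g h] orbit_self[OF f] conj by simp
  have "orbit g ` {1..n} = orbit g ` h ` {1..n}" using permutes_image[OF h] by simp
  also have "\<dots> = (`) h ` orbit f ` {1..n}" by (auto simp: img image_image)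
  finally have "num_cycles n g = card ((`) h ` orbit f ` {1..n})" unfolding num_cycles_def by simp
  also have "\<dots> = card (orbit f ` {1..n})"
    by (rule card_image, rule inj_onI) (use permutes_inj[OF h] in \<open>simp add: inj_image_eq_iff\<close>)
  finally show ?thesis unfolding num_cycles_def .
qed

section \<open>Multiplication by a transposition\<close>

text \<open>The factor exchanges the images of \<open>a\<close> and \<open>b\<close>, which splices
  their two cycles into one and leaves every other cycle alone.\<close>

lemma orbit_comp_transpose_merge:
  assumes f: "f permutes S" "finite S" and ab: "b \<notin> orbit f a"
  defines "U \<equiv> orbit f a \<union> orbit f b"
  shows "orbit (f \<circ> transpose a b) x = (if x \<in> U then U else orbit f x)"
proof (cases "x \<in> U")
  case False
  then have "x \<notin> orbit f a" "x \<notin> orbit f b" by (auto simp: U_def)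
  then have "a \<notin> orbit f x" "b \<notin> orbit f x" using orbit_sym[OF f] by blast+
  then have "orbit (f \<circ> transpose a b) x = orbit f x"
    by (intro orbit_cong orbit_self[OF f]) (metis comp_apply transpose_apply_other)
  with False show ?thesis by simp
next
  case True
  \<comment> \<open>The new map sends \<open>c\<close> to \<open>f d\<close> and then agrees with
    \<open>f\<close> until the walk reaches \<open>d\<close>; it never meets \<open>c\<close>.
    Swapping the roles of \<open>c\<close> and \<open>d\<close> gives both halves of the
    splice.\<close>
  have sub: "orbit f d \<subseteq> orbit (f \<circ> transpose c d) c" if "c \<notin> orbit f d" for c d
  proof
    fix y assume "y \<in> orbit f d"
    then show "y \<in> orbit (f \<circ> transpose c d) c"
    proof induct
      case base
      then show ?case using orbit.base[of "f \<circ> transpose c d" c] by (simp del: o_apply add: comp_apply[of f _ c])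
    next
      case (step y)
      show ?case
      proof (cases "y = d")
        case True
        then show ?thesis using orbit.base[of "f \<circ> transpose c d" c] by (simp del: o_apply add: comp_apply[of f _ c])
      next
        case False
        moreover have "y \<noteq> c" using step that by auto
        ultimately show ?thesis using orbit.step[OF step(2)] by (simp del: o_apply add: comp_apply[of f _ y])
      qed
    qed
  qed
  let ?g = "f \<circ> transpose a b"
  have ba: "a \<notin> orbit f b" using ab orbit_sym[OF f] by blast
  have 1: "orbit f b \<subseteq> orbit ?g a" by (rule sub[OF ba])
  have 2: "orbit f a \<subseteq> orbit ?g b" using sub[OF ab] by (simp add: transpose_commute)
  have "b \<in> orbit ?g a" "a \<in> orbit ?g b" using 1 2 orbit_self[OF f] by blast+
  then have g: "U \<subseteq> orbit ?g a" using 1 2 unfolding U_def by (meson Un_least orbit_trans subset_iff)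
  have aU: "a \<in> U" "b \<in> U" using orbit_self[OF f] by (auto simp: U_def)
  have closed: "?g y \<in> U" if "y \<in> U" for y
  proof -
    have "transpose a b y \<in> U" using that aU by (simp add: transpose_def)
    then have "f (transpose a b y) \<in> U" unfolding U_def by (metis Un_iff orbit.step)
    then show ?thesis by simp
  qed
  have ga: "orbit ?g a = U" using g orbit_subset_closed[of a U ?g] aU closed by blast
  have "a \<in> orbit ?g a" using aU ga by simp
  then have "x \<in> orbit ?g a \<and> a \<in> orbit ?g x" using True ga orbit_swap by metis
  then have "orbit ?g x = orbit ?g a" by (auto intro: orbit_trans)
  with True ga show ?thesis by simp
qed

lemma num_cycles_comp_transpose_merge:
  assumes f: "f permutes {1..n}" and ab: "b \<notin> orbit f a" "a \<in> {1..n}" "b \<in> {1..n}"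
  shows "num_cycles n f = num_cycles n (f \<circ> transpose a b) + 1"
proof -
  define U where "U = orbit f a \<union> orbit f b"
  let ?O = "orbit f ` {1..n}"
  note self = orbit_self[OF f finite_atLeastAtMost]
  note eq = orbit_eq[OF f finite_atLeastAtMost]
  have mem: "x \<in> U \<longleftrightarrow> orbit f x = orbit f a \<or> orbit f x = orbit f b" for x
    using self eq unfolding U_def by blast
  have "orbit (f \<circ> transpose a b) ` {1..n} = insert U (?O - {orbit f a, orbit f b})"
    using ab(2,3) mem unfolding orbit_comp_transpose_merge[OF f finite_atLeastAtMost ab(1), folded U_def]
    by auto
  moreover have "U \<notin> ?O"
  proof
    assume "U \<in> ?O"
    then obtain x where "U = orbit f x" by auto
    then have "orbit f a = orbit f x" "orbit f b = orbit f x"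
      using self eq unfolding U_def by (metis Un_iff)+
    with ab self show False by metis
  qed
  moreover have "orbit f a \<noteq> orbit f b" using ab self by metis
  moreover have "finite ?O" "orbit f a \<in> ?O" "orbit f b \<in> ?O" using ab by auto
  \<comment> \<open>Two orbits are removed and one is added; this bound keeps the natural-number
    subtraction from truncating.\<close>
  moreover from this \<open>orbit f a \<noteq> orbit f b\<close> have "2 \<le> card ?O"
    using card_mono[of ?O "{orbit f a, orbit f b}"] by simp
  ultimately show ?thesis unfolding num_cycles_def by (simp add: card_Diff_subset)
qed

text \<open>The stretch \<open>T\<close> of the cycle from \<open>f a\<close> to the first
  occurrence of \<open>b\<close> closes up under the new map, since \<open>b\<close> is now sent to
  \<open>f a\<close>. It does not contain \<open>a\<close>.\<close>

lemma orbit_comp_transpose_split: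
  assumes f: "f permutes S" "finite S" and ab: "b \<in> orbit f a" "a \<noteq> b"
  shows "b \<notin> orbit (f \<circ> transpose a b) a"
proof -
  let ?g = "f \<circ> transpose a b"
  define m where "m = funpow_dist1 f a b"
  define T where "T = {(f ^^ s) a | s. 0 < s \<and> s \<le> m}"
  have m: "(f ^^ m) a = b" "0 < m" using funpow_dist1_prop[OF ab(1)] by (auto simp: m_def)
  have neq: "(f ^^ s) a \<noteq> b" if "0 < s" "s < m" for s
    using funpow_dist1_least that unfolding m_def by metis
  \<comment> \<open>A return to \<open>a\<close> after \<open>s\<close> steps would leave
    \<open>b\<close> reachable in \<open>m - s\<close> steps, against the minimality of
    \<open>m\<close>.\<close>
  have a: "a \<notin> T"
  proof
    assume "a \<in> T"
    then obtain s where s: "(f ^^ s) a = a" "0 < s" "s \<le> m" unfolding T_def mem_Collect_eq by metis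
    with m ab have "s < m" by (metis le_neq_implies_less)
    moreover have "(f ^^ (m - s)) a = b"
      using s m by (metis comp_apply funpow_add le_add_diff_inverse2)
    ultimately show False using neq[of "m - s"] s by simp
  qed
  have "orbit ?g b \<subseteq> T"
  proof (rule orbit_subset_closed)
    show "b \<in> T" using m unfolding T_def by auto
    fix y assume y: "y \<in> T"
    then obtain s where s: "y = (f ^^ s) a" "0 < s" "s \<le> m" unfolding T_def by auto
    show "?g y \<in> T"
    proof (cases "y = b")
      case True
      moreover have "f a = (f ^^ 1) a" by simp
      ultimately show ?thesis using m unfolding T_def by (auto intro!: exI[of _ 1])
    next
      case False
      moreover have "y \<noteq> a" using y a by auto
      moreover have "f y = (f ^^ Suc s) a" using s by simp
      moreover have "s < m" using s m False by (metis le_neq_implies_less)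
      ultimately show ?thesis unfolding T_def by (auto intro!: exI[of _ "Suc s"])
    qed
  qed
  then have *: "a \<notin> orbit ?g b" using a by auto
  \<comment> \<open>Outside \<open>S\<close> every point is fixed, so its orbit could not contain a
    second point \<open>b\<close>.\<close>
  have "a \<in> S"
    using ab permutes_not_in[OF f(1), of a] orbit_eq_singleton_iff[of f a] by auto
  moreover from this have "b \<in> S" using ab permutes_orbit_subset[OF f(1)] by blast
  ultimately have "?g permutes S" using f by (intro permutes_compose permutes_swap_id)
  then show ?thesis using orbit_sym[OF _ f(2)] * by blast
qed

text \<open>A transposition is an involution, so cutting is the merging count read backwards from
  \<open>f \<circ> transpose a b\<close>.\<close>

lemma num_cycles_comp_transpose_split:
  assumes f: "f permutes {1..n}" and ab: "b \<in> orbit f a" "a \<noteq> b" "a \<in> {1..n}" "b \<in> {1..n}"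
  shows "num_cycles n (f \<circ> transpose a b) = num_cycles n f + 1"
proof -
  have "f \<circ> transpose a b permutes {1..n}" using f ab by (intro permutes_compose permutes_swap_id)
  moreover have "b \<notin> orbit (f \<circ> transpose a b) a"
    by (rule orbit_comp_transpose_split[OF f _ ab(1,2)]) simp
  ultimately have "num_cycles n (f \<circ> transpose a b) = num_cycles n (f \<circ> transpose a b \<circ> transpose a b) + 1"
    using ab(3,4) by (rule num_cycles_comp_transpose_merge)
  then show ?thesis by (simp add: comp_assoc)
qed

section \<open>Cycles given by lists\<close>

lemma cycle_of_list_nth:
  assumes "distinct xs" "m < length xs"
  shows "(cycle_of_list xs ^^ r) (xs ! m) = xs ! ((r + m) mod length xs)"
proof -
  have "(cycle_of_list xs ^^ r) (xs ! m) = map (cycle_of_list xs ^^ r) xs ! m" using assms by simp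
  also have "\<dots> = rotate r xs ! m" using cyclic_rotation[OF assms(1)] by simp
  also have "\<dots> = xs ! ((r + m) mod length xs)" using assms by (simp add: nth_rotate)
  finally show ?thesis .
qed

lemma orbit_cycle_of_list:
  assumes "distinct xs" "x \<in> set xs"
  shows "orbit (cycle_of_list xs) x = set xs"
proof -
  obtain m where m: "m < length xs" "x = xs ! m" using assms by (auto simp: in_set_conv_nth)
  have "xs ! s \<in> orbit (cycle_of_list xs) x" if "s < length xs" for s
  proof -
    \<comment> \<open>The exponent passes the end of the list once, so it is positive even when
      \<open>s \<le> m\<close>, as membership in \<open>orbit\<close> requires.\<close>
    have "(cycle_of_list xs ^^ (length xs - m + s)) x = xs ! s"
      using cycle_of_list_nth[OF assms(1) m(1), of "length xs - m + s"] m that by simp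
    moreover have "0 < length xs - m + s" using m by simp
    ultimately show ?thesis unfolding orbit_altdef by (auto intro!: exI[of _ "length xs - m + s"])
  qed
  then have "set xs \<subseteq> orbit (cycle_of_list xs) x" by (auto simp: in_set_conv_nth)
  moreover have "orbit (cycle_of_list xs) x \<subseteq> set xs"
    using permutes_orbit_subset cycle_permutes assms by metis
  ultimately show ?thesis by blast
qed

lemma cycle_of_sorted_list_consecutive:
  fixes p :: "nat set"
  assumes p: "finite p" "u \<in> p" "v \<in> p" "u < v" and gap: "p \<inter> {u<..<v} = {}"
  shows "cycle_of_list (sorted_list_of_set p) u = v"
proof -
  let ?xs = "sorted_list_of_set p"
  obtain a b where a: "a < length ?xs" "u = ?xs ! a" and b: "b < length ?xs" "v = ?xs ! b"
    using p by (metis in_set_conv_nth set_sorted_list_of_set)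
  have mono: "?xs ! c < ?xs ! d" if "c < d" "d < length ?xs" for c d
    using sorted_wrt_nth_less[OF strict_sorted_list_of_set that] .
  have "a < b" using a b p(4) mono by (metis linorder_neqE_nat order_less_asym)
  moreover have "\<not> Suc a < b"
  proof
    assume "Suc a < b"
    then have "?xs ! Suc a \<in> {u<..<v}" using mono a b by simp
    moreover have "?xs ! Suc a \<in> p" using \<open>Suc a < b\<close> b p(1) by (metis nth_mem order_less_trans set_sorted_list_of_set)
    ultimately show False using gap by auto
  qed
  ultimately have "b = Suc a" by simp
  then show ?thesis using cycle_of_list_nth[of ?xs a 1] a b by simp
qed

lemma zeta_apply: "zeta n x = (if x \<in> {1..n} then if x = n then 1 else x + 1 else x)"
proof (cases "x \<in> {1..n}")
  case True
  \<comment> \<open>The entry \<open>x\<close> stands at position \<open>x - 1\<close>; one step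
    leads to position \<open>x mod n\<close>, which wraps to 0 at \<open>x = n\<close>.\<close>
  then have "zeta n x = [1..<Suc n] ! (x mod n)"
    using cycle_of_list_nth[of "[1..<Suc n]" "x - 1" 1]
    by (auto simp: zeta_def nth_upt simp del: upt_Suc)
  with True show ?thesis by (simp add: nth_upt del: upt_Suc)
next
  case False
  then have "x \<notin> set [1..<Suc n]" by (auto simp del: upt_Suc)
  then have "zeta n x = x" unfolding zeta_def by (rule id_outside_supp)
  with False show ?thesis by (simp only: if_False)
qed

lemma zeta_permutes: "zeta n permutes {1..n}"
  using cycle_permutes[of "[1..<Suc n]"] unfolding zeta_def
  by (metis atLeastLessThanSuc_atLeastAtMost set_upt)

text \<open>Take the last element up to \<open>c\<close> and the first one beyond it. This finds the
  arc of a block that passes over the gap between \<open>c\<close> and \<open>c + 1\<close>.\<close>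

lemma consecutive_around:
  fixes p :: "nat set"
  assumes "finite p" "a \<in> p" "b \<in> p" "a \<le> c" "c < b"
  obtains u v where "u \<in> p" "v \<in> p" "a \<le> u" "u \<le> c" "c < v" "v \<le> b" "p \<inter> {u<..<v} = {}"
proof -
  let ?L = "{y \<in> p. y \<le> c}" and ?R = "{y \<in> p. c < y}"
  have L: "finite ?L" "a \<in> ?L" and R: "finite ?R" "b \<in> ?R" using assms by auto
  have "Max ?L \<in> ?L" "Min ?R \<in> ?R" using Max_in[OF L(1)] Min_in[OF R(1)] L(2) R(2) by blast+
  moreover have "a \<le> Max ?L" "Min ?R \<le> b" using L R by auto
  moreover have "p \<inter> {Max ?L<..<Min ?R} = {}"
  proof (rule ccontr)
    assume "p \<inter> {Max ?L<..<Min ?R} \<noteq> {}"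
    then obtain y where y: "y \<in> p" "Max ?L < y" "y < Min ?R" by auto
    show False
    proof (cases "y \<le> c")
      case True then show ?thesis using y Max_ge[OF L(1), of y] by (simp add: not_less[symmetric])
    next
      case False then show ?thesis using y Min_le[OF R(1), of y] by (simp add: not_less[symmetric])
    qed
  qed
  ultimately show ?thesis using that by blast
qed

subsection \<open>The Kreweras complement of a noncrossing partition\<close>

locale noncrossing_partition =
  fixes n :: nat and P :: "nat set set"
  assumes part: "partition_on {1..n} P" and noncrossing: "noncrossing P"
begin

abbreviation "\<beta> \<equiv> block_perm P"

definition "kreweras = inv \<beta> \<circ> zeta n"

lemma block_subset: "p \<in> P \<Longrightarrow> p \<subseteq> {1..n}"
  using partition_onD1[OF part] by blast

lemma finite_block: "p \<in> P \<Longrightarrow> finite p"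
  using block_subset finite_subset by blast

lemma block_of: "x \<in> {1..n} \<Longrightarrow> \<exists>p\<in>P. x \<in> p"
  using partition_onD1[OF part] by blast

lemma block_unique: "p \<in> P \<Longrightarrow> q \<in> P \<Longrightarrow> x \<in> p \<Longrightarrow> x \<in> q \<Longrightarrow> p = q"
  using partition_onD2[OF part] by (meson disjointD disjoint_iff)

lemma not_crossing:
  assumes "p \<in> P" "q \<in> P" "p \<noteq> q" "a \<in> p" "b \<in> q" "c \<in> p" "d \<in> q" "a < b" "b < c"
  shows "\<not> c < d"
proof
  assume "c < d"
  with assms have "\<exists>a b c d. a < b \<and> b < c \<and> c < d \<and> a \<in> p \<and> c \<in> p \<and> b \<in> q \<and> d \<in> q"
    by (intro exI[of _ a] exI[of _ b] exI[of _ c] exI[of _ d]) simp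
  with assms(1-3) have "\<not> noncrossing P"
    unfolding noncrossing_def not_not by (intro bexI[of _ p] bexI[of _ q] conjI)
  with noncrossing show False by contradiction
qed

lemma block_perm_on_block:
  assumes "p \<in> P" "x \<in> p"
  shows "\<beta> x = cycle_of_list (sorted_list_of_set p) x"
proof -
  have "(THE p. p \<in> P \<and> x \<in> p) = p" using assms block_unique by (intro the_equality) auto
  with assms show ?thesis by (auto simp: block_perm_def)
qed

lemma block_perm_bij_betw: "p \<in> P \<Longrightarrow> bij_betw \<beta> p p"
proof -
  assume p: "p \<in> P"
  have "bij_betw (cycle_of_list (sorted_list_of_set p)) p p"
    using permutes_imp_bij[OF cycle_permutes[of "sorted_list_of_set p"]] finite_block[OF p] by simp
  moreover have "bij_betw \<beta> p p \<longleftrightarrow> bij_betw (cycle_of_list (sorted_list_of_set p)) p p"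
    by (rule bij_betw_cong) (rule block_perm_on_block[OF p])
  ultimately show ?thesis by simp
qed

lemma block_perm_permutes: "\<beta> permutes {1..n}"
proof (rule bij_imp_permutes)
  have "bij_betw \<beta> (\<Union>p\<in>P. p) (\<Union>p\<in>P. p)"
  proof -
    have "inj_on \<beta> (\<Union>p\<in>P. p)"
    proof (rule inj_onI)
      fix x y assume "x \<in> (\<Union>p\<in>P. p)" "y \<in> (\<Union>p\<in>P. p)" and eq: "\<beta> x = \<beta> y"
      then obtain p q where pq: "p \<in> P" "x \<in> p" "q \<in> P" "y \<in> q" by auto
      then have "\<beta> x \<in> p" "\<beta> y \<in> q" using block_perm_bij_betw bij_betwE by blast+
      then have "p = q" using pq eq block_unique by metis
      then show "x = y" using pq eq block_perm_bij_betw[of p] by (auto simp: bij_betw_def inj_on_def)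
    qed
    moreover have "\<beta> ` (\<Union>p\<in>P. p) = (\<Union>p\<in>P. p)"
    proof -
      have "\<beta> ` p = p" if "p \<in> P" for p
        using block_perm_bij_betw[OF that] by (rule bij_betw_imp_surj_on)
      then show ?thesis unfolding image_UN by (rule SUP_cong[OF refl])
    qed
    ultimately show ?thesis by (simp add: bij_betw_def)
  qed
  then show "bij_betw \<beta> {1..n} {1..n}" using partition_onD1[OF part] by simp
  show "\<beta> x = x" if "x \<notin> {1..n}" for x
    using that partition_onD1[OF part] by (simp only: block_perm_def if_False)
qed

lemma orbit_block_perm:
  assumes p: "p \<in> P" "x \<in> p"
  shows "orbit \<beta> x = p"
proof -
  have "orbit \<beta> x = orbit (cycle_of_list (sorted_list_of_set p)) x"
  proof (rule orbit_cong0[OF p(2)])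
    show "\<beta> \<in> p \<rightarrow> p" using block_perm_bij_betw[OF p(1)] bij_betwE by blast
  qed (rule block_perm_on_block[OF p(1)])
  also have "\<dots> = p"
    using orbit_cycle_of_list[of "sorted_list_of_set p" x] p finite_block[OF p(1)] by simp
  finally show ?thesis .
qed

lemma block_perm_consecutive:
  assumes "p \<in> P" "u \<in> p" "v \<in> p" "u < v" "p \<inter> {u<..<v} = {}"
  shows "\<beta> u = v"
  using assms block_perm_on_block cycle_of_sorted_list_consecutive finite_block by simp

lemma kreweras_permutes: "kreweras permutes {1..n}"
  unfolding kreweras_def
  by (intro permutes_compose zeta_permutes permutes_inv block_perm_permutes)

lemmas orbit_kreweras_self = orbit_self[OF kreweras_permutes finite_atLeastAtMost]
lemmas orbit_kreweras_sym = orbit_sym[OF kreweras_permutes finite_atLeastAtMost]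

lemma inv_block_perm_in_block:
  assumes "p \<in> P" "x \<in> p"
  shows "inv \<beta> x \<in> p"
proof -
  obtain y where "y \<in> p" "\<beta> y = x" using block_perm_bij_betw assms by (metis bij_betw_imp_surj_on imageE)
  then show ?thesis using block_perm_permutes permutes_inverses(2) by metis
qed

lemma kreweras_Suc: "1 \<le> x \<Longrightarrow> x < n \<Longrightarrow> kreweras x = inv \<beta> (x + 1)"
  by (simp add: kreweras_def zeta_apply)

section \<open>Cycles of the Kreweras complement\<close>

text \<open>The point \<open>v - 1\<close> goes to \<open>inv \<beta> v = u\<close>. For any other
  \<open>y\<close> in the arc, the block of \<open>y + 1\<close> is nested strictly between
  \<open>u\<close> and \<open>v\<close> by noncrossingness, and it contains the image of
  \<open>y\<close>. So the cycles of \<open>kreweras\<close> cannot leave an arc.\<close>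

lemma kreweras_arc:
  assumes p: "p \<in> P" "u \<in> p" "v \<in> p" "u < v" and gap: "p \<inter> {u<..<v} = {}" and x: "x \<in> {u..<v}"
  shows "orbit kreweras x \<subseteq> {u..<v}"
proof (rule orbit_subset_closed[OF x])
  fix y assume y: "y \<in> {u..<v}"
  have uv: "u \<in> {1..n}" "v \<in> {1..n}" using p block_subset by blast+
  then have K: "kreweras y = inv \<beta> (y + 1)" using y by (intro kreweras_Suc) auto
  show "kreweras y \<in> {u..<v}"
  proof (cases "y + 1 = v")
    case True
    then have "kreweras y = u" using block_perm_consecutive[OF p gap] K
        permutes_inverses(2)[OF block_perm_permutes] by metis
    with p show ?thesis by simp
  next
    case False
    then have y1: "u < y + 1" "y + 1 < v" using y by auto
    then obtain q where q: "q \<in> P" "y + 1 \<in> q" using block_of[of "y + 1"] uv by auto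
    have "q \<noteq> p" using q y1 gap by auto
    have "q \<subseteq> {u<..<v}"
    proof
      fix z assume z: "z \<in> q"
      have "z \<noteq> u" "z \<noteq> v" using z \<open>q \<noteq> p\<close> p q block_unique by metis+
      moreover have "\<not> z < u" using not_crossing[OF q(1) p(1) \<open>q \<noteq> p\<close> z p(2) q(2) p(3)] y1 by blast
      moreover have "\<not> v < z"
        using not_crossing[OF p(1) q(1) \<open>q \<noteq> p\<close>[symmetric] p(2) q(2) p(3) z] y1 by blast
      ultimately show "z \<in> {u<..<v}" by auto
    qed
    moreover have "kreweras y \<in> q" using inv_block_perm_in_block[OF q] K by simp
    ultimately show ?thesis by auto
  qed
qed

text \<open>The image of \<open>y\<close> lies in the block of \<open>y + 1\<close>, and that block
  stays inside the interval. The domain \<open>{a..<b}\<close> is shifted by one against the range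
  \<open>{a+1..b}\<close>, so iteration can leave it only through \<open>b\<close>.\<close>

lemma kreweras_closed:
  assumes sep: "\<forall>q\<in>P. q \<subseteq> {a+1..b} \<or> q \<inter> {a+1..b} = {}" and "b \<le> n" "y \<in> {a..<b}" "1 \<le> a"
  shows "kreweras y \<in> {a+1..b}"
proof -
  have y: "y + 1 \<in> {1..n}" "y + 1 \<in> {a+1..b}" using assms by auto
  obtain q where q: "q \<in> P" "y + 1 \<in> q" using block_of[OF y(1)] by auto
  then have "q \<subseteq> {a+1..b}" using sep y(2) by blast
  moreover have "kreweras y \<in> q" using inv_block_perm_in_block[OF q] kreweras_Suc[of y] assms by simp
  ultimately show ?thesis by auto
qed

text \<open>A block with points inside and outside the interval has an arc over the gap after
  \<open>a\<close> or after \<open>b\<close>. This arc confines the cycle of \<open>a\<close> or of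
  \<open>b\<close> and excludes the other point. Conversely, if no block straddles, a walk from
  \<open>a\<close> that avoided \<open>b\<close> would remain in \<open>{a+1..b}\<close> and could
  not return to \<open>a\<close>.\<close>

lemma orbit_kreweras_iff:
  assumes "1 \<le> a" "a \<le> b" "b \<le> n"
  shows "b \<in> orbit kreweras a \<longleftrightarrow> (\<forall>q\<in>P. q \<subseteq> {a+1..b} \<or> q \<inter> {a+1..b} = {})"
proof
  assume b: "b \<in> orbit kreweras a"
  show "\<forall>q\<in>P. q \<subseteq> {a+1..b} \<or> q \<inter> {a+1..b} = {}"
  proof (rule ccontr)
    assume "\<not> ?thesis"
    then obtain q s t where q: "q \<in> P" "s \<in> q" "t \<in> q" "s \<in> {a+1..b}" "t \<notin> {a+1..b}" by blast
    show False
    proof (cases "t \<le> a")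
      case True
      moreover have "a < s" using q(4) by simp
      ultimately obtain u v where
        uv: "u \<in> q" "v \<in> q" "t \<le> u" "u \<le> a" "a < v" "v \<le> s" "q \<inter> {u<..<v} = {}"
        by (rule consecutive_around[OF finite_block[OF q(1)] q(3,2)])
      then have "orbit kreweras a \<subseteq> {u..<v}" using q(1) by (intro kreweras_arc) auto
      then show False using b uv q(4) by auto
    next
      case False
      then have "s \<le> b" "b < t" using q(4,5) by auto
      then obtain u v where
        uv: "u \<in> q" "v \<in> q" "s \<le> u" "u \<le> b" "b < v" "v \<le> t" "q \<inter> {u<..<v} = {}"
        by (rule consecutive_around[OF finite_block[OF q(1)] q(2,3)])
      then have "orbit kreweras b \<subseteq> {u..<v}" using q(1) by (intro kreweras_arc) auto
      then show False using orbit_kreweras_sym[OF b] uv q(4) by auto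
    qed
  qed
next
  assume sep: "\<forall>q\<in>P. q \<subseteq> {a+1..b} \<or> q \<inter> {a+1..b} = {}"
  show "b \<in> orbit kreweras a"
  proof (rule ccontr)
    assume nb: "b \<notin> orbit kreweras a"
    then have "a < b" using assms orbit_kreweras_self[of a] by (metis le_neq_implies_less)
    have "y \<in> {a+1..b}" if "y \<in> orbit kreweras a" for y
      using that
    proof induct
      case base
      then show ?case using kreweras_closed[OF sep] assms \<open>a < b\<close> by simp
    next
      case (step y)
      then have "y \<noteq> b" using nb by auto
      with step have "y \<in> {a..<b}" by auto
      then show ?case using kreweras_closed[OF sep] assms by simp
    qed
    from this[OF orbit_kreweras_self] show False by simp
  qed
qed

text \<open>Counting the cycles of \<open>K\<close> by their maxima and the blocks by their minima gives two sets that
  are, after a shift by 1, complementary in \<open>{1..<n}\<close>; this is why the counts add up to \<open>n + 1\<close>.\<close>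

lemma Max_orbit_kreweras:
  assumes x: "x \<in> {1..<n}"
  shows "Max (orbit kreweras x) = x \<longleftrightarrow> Min (orbit \<beta> (x + 1)) \<noteq> x + 1"
proof -
  obtain p where p: "p \<in> P" "x + 1 \<in> p" using block_of[of "x + 1"] x by auto
  have fin: "finite (orbit kreweras x)" using finite_orbit orbit_kreweras_self by metis
  have min: "orbit \<beta> (x + 1) = p" using orbit_block_perm[OF p] .
  show ?thesis
  proof (cases "Min p = x + 1")
    case True
    \<comment> \<open>If \<open>x + 1\<close> is the least element of its block, the image of
      \<open>x\<close> lies in that block and therefore exceeds \<open>x\<close>.\<close>
    have "kreweras x \<in> p" using inv_block_perm_in_block[OF p] kreweras_Suc[of x] x by simp
    then have "x + 1 \<le> kreweras x" using True finite_block[OF p(1)] by (metis Min_le)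
    moreover have "kreweras x \<le> Max (orbit kreweras x)" using fin orbit.base by (rule Max_ge)
    ultimately show ?thesis using True min by simp
  next
    case False
    \<comment> \<open>Otherwise \<open>x + 1\<close> has a predecessor \<open>u\<close> in its
      block, and the arc from \<open>u\<close> to \<open>v = x + 1\<close> confines the cycle of
      \<open>x\<close> to points up to \<open>x\<close>.\<close>
    have "Min p \<in> p" "Min p \<le> x + 1" using p finite_block[OF p(1)] by (auto intro: Min_in)
    moreover from this False have "Min p \<le> x" "x < x + 1" by auto
    ultimately obtain u v where
      uv: "u \<in> p" "v \<in> p" "Min p \<le> u" "u \<le> x" "x < v" "v \<le> x + 1" "p \<inter> {u<..<v} = {}"
      using consecutive_around[OF finite_block[OF p(1)] _ p(2)] by metis
    then have "orbit kreweras x \<subseteq> {u..<v}" using p(1) by (intro kreweras_arc) auto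
    then have "y \<le> x" if "y \<in> orbit kreweras x" for y using that uv by fastforce
    then have "Max (orbit kreweras x) = x" using fin orbit_kreweras_self by (intro Max_eqI) auto
    with False min show ?thesis by simp
  qed
qed

lemma num_cycles_kreweras:
  assumes "1 \<le> n"
  shows "num_cycles n \<beta> + num_cycles n kreweras = n + 1"
proof -
  let ?M = "{x \<in> {1..<n}. Max (orbit kreweras x) = x}"
  let ?B = "{x \<in> {1..<n}. Min (orbit \<beta> (x + 1)) = x + 1}"
  have finK: "finite (orbit kreweras x)" for x using finite_orbit orbit_kreweras_self by metis
  have finB: "finite (orbit \<beta> x)" for x
    using finite_orbit orbit_self[OF block_perm_permutes finite_atLeastAtMost] by metis
  have "n \<in> {1..n}" "1 \<in> {1..n}" using assms by auto
  then have sub: "orbit kreweras n \<subseteq> {1..n}" "orbit \<beta> 1 \<subseteq> {1..n}"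
    using permutes_orbit_subset[OF kreweras_permutes] permutes_orbit_subset[OF block_perm_permutes]
    by simp_all
  \<comment> \<open>The point \<open>n\<close> is always the maximum of its cycle, as 1 below is
    always the minimum of its block. These two add 2 to the \<open>n - 1\<close> points of
    \<open>?M\<close> and \<open>?B\<close>.\<close>
  have "Max (orbit kreweras n) = n"
    using sub finK orbit_kreweras_self by (intro Max_eqI) auto
  then have "{x \<in> {1..n}. Max (orbit kreweras x) = x} = insert n ?M" using assms by auto
  moreover have "num_cycles n kreweras = card {x \<in> {1..n}. Max (orbit kreweras x) = x}"
    using finK orbit_nonempty by (intro num_cycles_representatives kreweras_permutes Max_in)
  ultimately have K: "num_cycles n kreweras = card ?M + 1" by simp
  have "Min (orbit \<beta> 1) = 1"
    using sub finB orbit_self[OF block_perm_permutes finite_atLeastAtMost] by (intro Min_eqI) auto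
  then have "{x \<in> {1..n}. Min (orbit \<beta> x) = x} = insert 1 (Suc ` ?B)"
  proof (intro equalityI subsetI)
    fix x assume "x \<in> {x \<in> {1..n}. Min (orbit \<beta> x) = x}"
    then show "x \<in> insert 1 (Suc ` ?B)" by (cases x rule: nat.exhaust) (auto simp: image_iff)
  qed (use assms in auto)
  moreover have "1 \<notin> Suc ` ?B" by auto
  moreover have "num_cycles n \<beta> = card {x \<in> {1..n}. Min (orbit \<beta> x) = x}"
    using finB orbit_nonempty by (intro num_cycles_representatives block_perm_permutes Min_in)
  ultimately have B: "num_cycles n \<beta> = card ?B + 1" by (simp add: card_image)
  have "?M \<inter> ?B = {}" "?M \<union> ?B = {1..<n}" using Max_orbit_kreweras by auto
  then have "card ?M + card ?B = n - 1"
    using card_Un_disjoint[of ?M ?B] by simp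
  with K B assms show ?thesis by simp
qed

end

subsection \<open>Four-colorings\<close>

lemma ex_color: "(\<exists>X. Q X) \<longleftrightarrow> Q ColA \<or> Q ColB \<or> Q ColC \<or> Q ColD"
  by (metis color.exhaust)

lemma card_colors_ge_3:
  fixes Q :: "color \<Rightarrow> bool"
  shows "card {X. Q X} \<ge> 3 \<longleftrightarrow> (\<exists>X Y Z. X \<noteq> Y \<and> X \<noteq> Z \<and> Y \<noteq> Z \<and> Q X \<and> Q Y \<and> Q Z)"
proof
  assume "card {X. Q X} \<ge> 3"
  then obtain T where "T \<subseteq> {X. Q X}" "card T = 3" using obtain_subset_with_card_n by metis
  then show "\<exists>X Y Z. X \<noteq> Y \<and> X \<noteq> Z \<and> Y \<noteq> Z \<and> Q X \<and> Q Y \<and> Q Z"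
    unfolding card_3_iff by blast
next
  assume "\<exists>X Y Z. X \<noteq> Y \<and> X \<noteq> Z \<and> Y \<noteq> Z \<and> Q X \<and> Q Y \<and> Q Z"
  then obtain X Y Z where XYZ: "X \<noteq> Y" "X \<noteq> Z" "Y \<noteq> Z" "{X, Y, Z} \<subseteq> {X. Q X}" by auto
  have "UNIV = {ColA, ColB, ColC, ColD}" using color.exhaust by auto
  then have "finite (UNIV :: color set)" by (metis finite.emptyI finite_insert)
  then have "finite {X. Q X}" by (rule finite_subset[OF subset_UNIV])
  from card_mono[OF this XYZ(4)] XYZ(1-3) show "card {X. Q X} \<ge> 3" by simp
qed

text \<open>Here \<open>m p X\<close> is to be read as "block \<open>p\<close> meets color
  \<open>X\<close>". Keeping the incidence abstract separates the finite color argument from the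
  intervals.\<close>

definition splits :: "('a \<Rightarrow> color \<Rightarrow> bool) \<Rightarrow> 'a \<Rightarrow> color set \<Rightarrow> bool" where
  "splits m p W \<longleftrightarrow> (\<exists>X\<in>W. m p X) \<and> (\<exists>X. X \<notin> W \<and> m p X)"

text \<open>Regard colors as vertices, with an edge for each pair met by a common block. The left
  side asks for edges across certain cuts, the right side for two distinct edges with a common
  vertex. Any such pair of edges crosses all the cuts. Without one the edges form a matching, and
  the only matching that passes all four conditions is AC with BD, which \<open>cross\<close> rules
  out.\<close>

lemma split_colors_iff:
  fixes m :: "'a \<Rightarrow> color \<Rightarrow> bool"
  assumes cross: "\<And>p q. p \<in> P \<Longrightarrow> q \<in> P \<Longrightarrow> m p ColA \<Longrightarrow> m p ColC \<Longrightarrow> m q ColB \<Longrightarrow> m q ColD \<Longrightarrow> p = q"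
  shows "(\<exists>p\<in>P. splits m p {ColB, ColC}) \<and> (\<exists>p\<in>P. splits m p {ColC, ColD}) \<and>
      (\<exists>p\<in>P. splits m p {ColB} \<or> splits m p {ColD}) \<and>
      (\<exists>p\<in>P. splits m p {ColC} \<or> splits m p {ColB, ColC, ColD}) \<longleftrightarrow>
      (\<exists>p\<in>P. card {X. m p X} \<ge> 3) \<or>
      (\<exists>p\<in>P. \<exists>q\<in>P. \<exists>X Y Z. p \<noteq> q \<and> X \<noteq> Y \<and> X \<noteq> Z \<and> Y \<noteq> Z \<and>
         m p X \<and> m p Y \<and> (\<forall>W. W \<notin> {X, Y} \<longrightarrow> \<not> m p W) \<and>
         m q X \<and> m q Z \<and> (\<forall>W. W \<notin> {X, Z} \<longrightarrow> \<not> m q W))"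
    (is "?G \<longleftrightarrow> ?R1 \<or> ?R2")
proof -
  define joined where "joined X Y \<longleftrightarrow> (\<exists>p\<in>P. m p X \<and> m p Y)" for X Y
  have splits: "(\<exists>p\<in>P. splits m p W) \<longleftrightarrow> (\<exists>X Y. X \<in> W \<and> Y \<notin> W \<and> joined X Y)" for W
    unfolding splits_def joined_def by blast
  have sym: "joined X Y = joined Y X" for X Y unfolding joined_def by blast
  have G: "?G \<longleftrightarrow>
    (joined ColB ColA \<or> joined ColB ColD \<or> joined ColC ColA \<or> joined ColC ColD) \<and>
    (joined ColC ColA \<or> joined ColC ColB \<or> joined ColD ColA \<or> joined ColD ColB) \<and>
    (joined ColB ColA \<or> joined ColB ColC \<or> joined ColB ColD \<or> joined ColD ColA \<or> joined ColD ColC) \<and>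
    (joined ColC ColA \<or> joined ColC ColB \<or> joined ColC ColD \<or> joined ColB ColA \<or> joined ColD ColA)"
    unfolding bex_disj_distrib splits ex_color by (simp add: disj_ac sym[of ColD ColB])
  show ?thesis
  proof
    assume g: ?G
    show "?R1 \<or> ?R2"
    proof (rule ccontr)
      assume "\<not> (?R1 \<or> ?R2)"
      then have r1: "\<not> ?R1" and r2: "\<not> ?R2" by blast+
      have three: False if "p \<in> P" "X \<noteq> Y" "X \<noteq> Z" "Y \<noteq> Z" "m p X" "m p Y" "m p Z" for p X Y Z
        using r1 that unfolding card_colors_ge_3 by blast
      \<comment> \<open>As no block meets three colors, the blocks behind the two pairs are distinct
        and meet no further color, which is what \<open>?R2\<close> asks for.\<close>
      have no: "\<not> (joined X Y \<and> joined X Z)" if "X \<noteq> Y" "X \<noteq> Z" "Y \<noteq> Z" for X Y Z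
      proof
        assume "joined X Y \<and> joined X Z"
        then obtain p q where pq: "p \<in> P" "m p X" "m p Y" "q \<in> P" "m q X" "m q Z" unfolding joined_def by blast
        have "p \<noteq> q" using three pq that by metis
        moreover have "\<forall>W. W \<notin> {X, Y} \<longrightarrow> \<not> m p W" "\<forall>W. W \<notin> {X, Z} \<longrightarrow> \<not> m q W"
          using three pq that by (metis insertCI)+
        ultimately show False using r2 pq that by metis
      qed
      \<comment> \<open>By \<open>cross\<close> the two blocks would coincide, giving one block with
        more than two colors.\<close>
      have c: "\<not> (joined ColA ColC \<and> joined ColB ColD)"
      proof
        assume "joined ColA ColC \<and> joined ColB ColD"
        then obtain p where "p \<in> P" "m p ColA" "m p ColC" "m p ColB"
          unfolding joined_def using cross by metis
        then show False using three[of p ColA ColC ColB] by simp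
      qed
      show False
        using g c no[of ColA ColB ColC] no[of ColA ColB ColD] no[of ColA ColC ColD]
          no[of ColB ColA ColC] no[of ColB ColA ColD] no[of ColB ColC ColD]
          no[of ColC ColA ColB] no[of ColC ColA ColD] no[of ColC ColB ColD]
          no[of ColD ColA ColB] no[of ColD ColA ColC] no[of ColD ColB ColC]
        unfolding G sym[of ColB ColA] sym[of ColC ColA] sym[of ColD ColA]
          sym[of ColC ColB] sym[of ColD ColB] sym[of ColD ColC]
        by (simp only: color.distinct not_False_eq_True simp_thms) argo
    qed
  next
    assume "?R1 \<or> ?R2"
    then obtain X Y Z where XYZ: "X \<noteq> Y" "X \<noteq> Z" "Y \<noteq> Z" and j: "joined X Y" "joined X Z"
      unfolding card_colors_ge_3 joined_def by blast
    show ?G unfolding G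
      using XYZ j j[unfolded sym[of X]]
      by (cases X; cases Y; cases Z; simp only: color.distinct not_True_eq_False simp_thms)
  qed
qed

section \<open>The relabeling and the long cycle\<close>

lemma relabel_apply:
  assumes "1 \<le> i" "i < j" "j \<le> k" "k < l" "l \<le> n"
  shows "x \<le> i \<Longrightarrow> relabel n i j k l x = x"
    and "i < x \<Longrightarrow> x \<le> j \<Longrightarrow> relabel n i j k l x = x + l - j"
    and "j < x \<Longrightarrow> x \<le> k \<Longrightarrow> relabel n i j k l x = x + i + l - j - k"
    and "k < x \<Longrightarrow> x \<le> l \<Longrightarrow> relabel n i j k l x = x + i - k"
    and "l < x \<Longrightarrow> relabel n i j k l x = x"
  using assms by (simp_all add: relabel_def)

text \<open>Relabeling rearranges the intervals into the order A, D, C, B, A, so successors change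
  only at the right ends \<open>i\<close>, \<open>j\<close>, \<open>k\<close>, \<open>l\<close>.
  There \<open>i\<close> is followed by the start of D, \<open>j\<close> by the successor of
  \<open>l\<close>, \<open>k\<close> by the start of B and \<open>l\<close> by the start of C. This
  is the effect of the two transpositions before \<open>zeta n\<close>.\<close>

lemma zeta_relabel:
  assumes b: "1 \<le> i" "i < j" "j \<le> k" "k < l" "l \<le> n"
  shows "zeta n (relabel n i j k l x) =
         relabel n i j k l (zeta n (transpose i k (transpose j l x)))"
proof -
  let ?t = "transpose i k (transpose j l x)"
  have zeta: "zeta n y = y + 1" if "1 \<le> y" "y < n" for y using that by (simp add: zeta_apply)
  note phi = relabel_apply[OF b]
  consider "x = i" | "x = j" | "x = k" "j < k" | "x = l" | "x \<notin> {i, j, k, l}" using b(3) by force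
  then show ?thesis
  proof cases
    case 1
    then have "?t = k" using b by (simp add: transpose_def)
    with 1 show ?thesis using b by (simp add: phi zeta)
  next
    case 2
    then have "?t = l" using b by (simp add: transpose_def)
    moreover have "relabel n i j k l x = l" "relabel n i j k l 1 = 1" "relabel n i j k l (l + 1) = l + 1"
      using 2 b by (simp_all add: phi)
    moreover have "zeta n l = 1 \<or> zeta n l = l + 1" using b by (simp add: zeta_apply)
    ultimately show ?thesis by metis
  next
    case 3
    then have "?t = i" using b by (simp add: transpose_def)
    with 3 show ?thesis using b by (simp add: phi zeta)
  next
    case 4
    \<comment> \<open>If C is empty, the transpositions share the point \<open>j = k\<close>, and D
      is followed directly by B.\<close>
    then have "?t = (if j = k then i else j)" using b by (simp add: transpose_def)
    moreover have "zeta n i = i + 1" "zeta n j = j + 1" using b by (simp_all add: zeta)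
    moreover have "relabel n i j k l (i + 1) = i + 1 + l - j" using b by (simp add: phi)
    moreover have "j < k \<Longrightarrow> relabel n i j k l (j + 1) = j + 1 + i + l - j - k" using b by (simp add: phi)
    ultimately have "relabel n i j k l (zeta n ?t) = l + i - k + 1" using b by (auto split: if_splits)
    moreover have "zeta n (relabel n i j k l x) = l + i - k + 1" using 4 b by (simp add: phi zeta)
    ultimately show ?thesis by simp
  next
    case 5
    then have t: "?t = x" by (simp add: transpose_def)
    from 5 consider "x = 0" | "1 \<le> x" "x < i" | "i < x" "x < j" | "j < x" "x < k" | "k < x" "x < l" | "l < x"
      by force
    then show ?thesis
    proof cases
      case 6
      then have "l < zeta n x \<or> zeta n x = 1" by (auto simp: zeta_apply)
      then have "relabel n i j k l (zeta n x) = zeta n x" using phi(1,5) b(1) by auto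
      with 6 show ?thesis by (simp add: phi t)
    qed (use b in \<open>simp_all add: t phi zeta zeta_apply[of n 0]\<close>)
  qed
qed

lemma relabel_permutes:
  assumes "1 \<le> i" "i < j" "j \<le> k" "k < l" "l \<le> n"
  shows "relabel n i j k l permutes {1..n}"
proof (rule bij_imp_permutes)
  have "inj_on (relabel n i j k l) {1..n}"
    using assms by (intro inj_onI) (auto simp: relabel_def split: if_splits)
  moreover have "relabel n i j k l ` {1..n} \<subseteq> {1..n}"
    using assms by (auto simp: relabel_def)
  ultimately show "bij_betw (relabel n i j k l) {1..n} {1..n}"
    by (simp add: bij_betw_def endo_inj_surj)
  show "relabel n i j k l x = x" if "x \<notin> {1..n}" for x
    using that assms by (auto simp: relabel_def)
qed

section \<open>The genus of the relabeled partition\<close>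

locale colored_partition = noncrossing_partition +
  fixes i j k l :: nat
  assumes bounds: "1 \<le> i" "i < j" "j \<le> k" "k < l" "l \<le> n"
begin

abbreviation "\<phi> \<equiv> relabel n i j k l"

lemma phi_permutes: "\<phi> permutes {1..n}"
  using relabel_permutes bounds .

lemma Phi_permutes: "Phi n P i j k l permutes {1..n}"
  unfolding Phi_def
  by (intro permutes_compose permutes_inv phi_permutes block_perm_permutes)

definition "kreweras' = kreweras \<circ> transpose i k"

lemma kreweras'_permutes: "kreweras' permutes {1..n}"
  unfolding kreweras'_def using bounds
  by (intro permutes_compose kreweras_permutes permutes_swap_id) auto

lemma num_cycles_Phi: "num_cycles n (Phi n P i j k l) = num_cycles n \<beta>"
  by (rule num_cycles_conjugate[OF block_perm_permutes phi_permutes])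
    (simp add: Phi_def permutes_inverses(2)[OF phi_permutes])

text \<open>The inverse of \<open>Phi\<close> moves past \<open>\<phi>\<close> as
  \<open>inv \<beta>\<close>, and \<open>zeta_relabel\<close> moves \<open>zeta n\<close> past
  \<open>\<phi>\<close> at the cost of the two transpositions.\<close>

lemma num_cycles_inv_Phi:
  "num_cycles n (inv (Phi n P i j k l) \<circ> zeta n) = num_cycles n (kreweras' \<circ> transpose j l)"
proof (rule num_cycles_conjugate[OF _ phi_permutes])
  show "kreweras' \<circ> transpose j l permutes {1..n}"
    using bounds by (intro permutes_compose kreweras'_permutes permutes_swap_id) auto
  fix x
  let ?y = "zeta n (transpose i k (transpose j l x))"
  have "Phi n P i j k l (\<phi> (inv \<beta> ?y)) = \<phi> ?y"
    by (simp add: Phi_def permutes_inverses[OF phi_permutes] permutes_inverses[OF block_perm_permutes])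
  then have "inv (Phi n P i j k l) (\<phi> ?y) = \<phi> (inv \<beta> ?y)"
    using Phi_permutes permutes_inverses(2) by metis
  then show "(inv (Phi n P i j k l) \<circ> zeta n) (\<phi> x) = \<phi> ((kreweras' \<circ> transpose j l) x)"
    by (simp add: zeta_relabel[OF bounds] kreweras'_def kreweras_def)
qed

lemma not_in_orbit_kreweras':
  assumes ik: "k \<in> orbit kreweras i"
  shows "l \<notin> orbit kreweras' j"
proof -
  have sep: "\<forall>q\<in>P. q \<subseteq> {i+1..k} \<or> q \<inter> {i+1..k} = {}"
    using ik orbit_kreweras_iff[of i k] bounds by simp
  have "orbit kreweras' j \<subseteq> {i+1..k}"
  proof (rule orbit_subset_closed)
    fix y assume y: "y \<in> {i+1..k}"
    \<comment> \<open>Replacing \<open>k\<close> by \<open>i\<close> turns the interval into exactly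
      the domain on which \<open>kreweras_closed\<close> applies.\<close>
    then have "transpose i k y \<in> {i..<k}" by (auto simp: transpose_def)
    then show "kreweras' y \<in> {i+1..k}"
      using kreweras_closed[OF sep] bounds by (simp add: kreweras'_def)
  qed (use bounds in auto)
  then show ?thesis using bounds by auto
qed

text \<open>One join and one cut restore the count \<open>n + 1\<close> of genus 0, while two joins
  lower it by 2. Two cuts are excluded by \<open>not_in_orbit_kreweras'\<close>.\<close>

lemma genus_Phi:
  "genus n (Phi n P i j k l) = (if k \<in> orbit kreweras i \<or> l \<in> orbit kreweras' j then 0 else 1)"
proof -
  have mem: "i \<in> {1..n}" "j \<in> {1..n}" "k \<in> {1..n}" "l \<in> {1..n}" "i \<noteq> k" "j \<noteq> l"
    using bounds by auto
  let ?z = "num_cycles n" and ?K = "kreweras' \<circ> transpose j l"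
  have sum: "?z \<beta> + ?z kreweras = n + 1" using num_cycles_kreweras bounds by simp
  have split_jl: "?z ?K = ?z kreweras' + 1" if "l \<in> orbit kreweras' j"
    using num_cycles_comp_transpose_split[OF kreweras'_permutes that] mem by simp
  have merge_jl: "?z kreweras' = ?z ?K + 1" if "l \<notin> orbit kreweras' j"
    using num_cycles_comp_transpose_merge[OF kreweras'_permutes that] mem by simp
  have split_ik: "?z kreweras' = ?z kreweras + 1" if "k \<in> orbit kreweras i"
    using num_cycles_comp_transpose_split[OF kreweras_permutes that] mem by (simp add: kreweras'_def)
  have merge_ik: "?z kreweras = ?z kreweras' + 1" if "k \<notin> orbit kreweras i"
    using num_cycles_comp_transpose_merge[OF kreweras_permutes that] mem by (simp add: kreweras'_def)
  show ?thesis
  proof (cases "k \<in> orbit kreweras i \<or> l \<in> orbit kreweras' j")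
    case True
    have "?z ?K = ?z kreweras"
    proof (cases "k \<in> orbit kreweras i")
      case True
      with not_in_orbit_kreweras' split_ik merge_jl show ?thesis by simp
    next
      case False
      with True split_jl merge_ik show ?thesis by simp
    qed
    with sum have "of_nat (?z \<beta>) + of_nat (?z ?K) = (of_nat n + 1 :: rat)"
      by (metis of_nat_1 of_nat_add)
    with True show ?thesis unfolding genus_def num_cycles_Phi num_cycles_inv_Phi by simp
  next
    case False
    then have "?z \<beta> + ?z ?K + 2 = n + 1" using sum merge_ik merge_jl by simp
    then have "of_nat (?z \<beta>) + of_nat (?z ?K) + 2 = (of_nat n + 1 :: rat)"
      by (metis of_nat_1 of_nat_add of_nat_numeral)
    with False show ?thesis unfolding genus_def num_cycles_Phi num_cycles_inv_Phi by simp
  qed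
qed

text \<open>If \<open>i\<close> and \<open>k\<close> lie on different cycles, multiplying by their
  transposition unites just these two. So \<open>j\<close> and \<open>l\<close> come to share a
  cycle only if they did before, or if one was on the cycle of \<open>i\<close> and the other on
  that of \<open>k\<close>.\<close>

lemma genus_Phi_eq_1_iff:
  "genus n (Phi n P i j k l) = 1 \<longleftrightarrow>
    k \<notin> orbit kreweras i \<and> l \<notin> orbit kreweras j \<and>
    \<not> (j \<in> orbit kreweras i \<and> l \<in> orbit kreweras k) \<and>
    \<not> (k \<in> orbit kreweras j \<and> l \<in> orbit kreweras i)"
proof (cases "k \<in> orbit kreweras i")
  case True
  then show ?thesis by (simp add: genus_Phi)
next
  case False
  let ?U = "orbit kreweras i \<union> orbit kreweras k"
  have sym: "x \<in> orbit kreweras y \<longleftrightarrow> y \<in> orbit kreweras x" for x y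
    using orbit_kreweras_sym by blast
  have "orbit kreweras' j = (if j \<in> ?U then ?U else orbit kreweras j)"
    using orbit_comp_transpose_merge[OF kreweras_permutes _ False] by (simp add: kreweras'_def)
  moreover have "l \<in> orbit kreweras j" if "j \<in> orbit kreweras x" "l \<in> orbit kreweras x" for x
    using that sym orbit_trans by metis
  moreover have "l \<in> orbit kreweras x" if "j \<in> orbit kreweras x" "l \<in> orbit kreweras j" for x
    using that orbit_trans by metis
  ultimately have "l \<in> orbit kreweras' j \<longleftrightarrow> l \<in> orbit kreweras j \<or>
      j \<in> orbit kreweras i \<and> l \<in> orbit kreweras k \<or> j \<in> orbit kreweras k \<and> l \<in> orbit kreweras i"
    by auto
  with False sym[of j k] show ?thesis by (simp add: genus_Phi)
qed

abbreviation "cls \<equiv> color_class n i j k l"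

definition "meets p X \<longleftrightarrow> p \<inter> cls X \<noteq> {}"

lemma color_exists: "x \<in> {1..n} \<Longrightarrow> \<exists>X. x \<in> cls X"
proof -
  assume "x \<in> {1..n}"
  then have "x \<in> cls ColA \<or> x \<in> cls ColB \<or> x \<in> cls ColC \<or> x \<in> cls ColD" by auto
  then show ?thesis by blast
qed

lemma color_unique: "x \<in> cls X \<Longrightarrow> x \<in> cls Y \<Longrightarrow> X = Y"
  using bounds by (cases X; cases Y) auto

lemma subset_colors_iff:
  assumes "p \<in> P"
  shows "p \<subseteq> \<Union>(cls ` W) \<longleftrightarrow> (\<forall>X. X \<notin> W \<longrightarrow> \<not> meets p X)"
proof
  assume sub: "p \<subseteq> \<Union>(cls ` W)"
  show "\<forall>X. X \<notin> W \<longrightarrow> \<not> meets p X"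
  proof (intro allI impI notI)
    fix X assume "X \<notin> W" "meets p X"
    then obtain x where x: "x \<in> p" "x \<in> cls X" unfolding meets_def by blast
    with sub obtain Y where "Y \<in> W" "x \<in> cls Y" by blast
    with x \<open>X \<notin> W\<close> color_unique show False by blast
  qed
next
  assume only: "\<forall>X. X \<notin> W \<longrightarrow> \<not> meets p X"
  show "p \<subseteq> \<Union>(cls ` W)"
  proof
    fix x assume x: "x \<in> p"
    then obtain X where X: "x \<in> cls X" using color_exists block_subset[OF assms] by blast
    with x have "meets p X" unfolding meets_def by blast
    with only have "X \<in> W" by blast
    with X show "x \<in> \<Union>(cls ` W)" by blast
  qed
qed

lemma disjoint_colors_iff: "p \<inter> \<Union>(cls ` W) = {} \<longleftrightarrow> (\<forall>X\<in>W. \<not> meets p X)"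
  unfolding meets_def by blast

text \<open>For an interval made of whole color classes, whether a block straddles it depends only
  on the colors that the block meets.\<close>

lemma orbit_kreweras_splits:
  assumes "1 \<le> a" "a \<le> b" "b \<le> n" "{a+1..b} = \<Union>(cls ` W)"
  shows "b \<in> orbit kreweras a \<longleftrightarrow> \<not> (\<exists>p\<in>P. splits meets p W)"
  unfolding orbit_kreweras_iff[OF assms(1-3)] assms(4) splits_def
  using subset_colors_iff disjoint_colors_iff by auto

text \<open>Points of the four colors follow each other cyclically as a, b, c, d. The class A lies
  partly before B and partly after D, so the linear order is a, b, c, d or b, c, d, a; both are
  crossings if the blocks differ.\<close>

lemma meets_cross:
  assumes "p \<in> P" "q \<in> P" "meets p ColA" "meets p ColC" "meets q ColB" "meets q ColD"
  shows "p = q"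
proof (rule ccontr)
  assume neq: "p \<noteq> q"
  obtain a b c d where
    a: "a \<in> p" "a \<in> cls ColA" and c: "c \<in> p" "c \<in> cls ColC" and
    b: "b \<in> q" "b \<in> cls ColB" and d: "d \<in> q" "d \<in> cls ColD"
    using assms unfolding meets_def by blast
  have "b < c" "c < d" "a < b \<or> d < a" using a b c d by auto
  then show False
    using not_crossing[OF assms(1,2) neq a(1) b(1) c(1) d(1)]
      not_crossing[OF assms(2,1) neq[symmetric] b(1) c(1) d(1) a(1)] by blast
qed

text \<open>Each pair among \<open>i\<close>, \<open>j\<close>, \<open>k\<close>, \<open>l\<close>
  bounds an interval that is a union of color classes, for instance \<open>{i+1..l}\<close> of B, C
  and D.\<close>

lemma genus_Phi_eq_1_iff_splits:
  "genus n (Phi n P i j k l) = 1 \<longleftrightarrow>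
    (\<exists>p\<in>P. splits meets p {ColB, ColC}) \<and> (\<exists>p\<in>P. splits meets p {ColC, ColD}) \<and>
    (\<exists>p\<in>P. splits meets p {ColB} \<or> splits meets p {ColD}) \<and>
    (\<exists>p\<in>P. splits meets p {ColC} \<or> splits meets p {ColB, ColC, ColD})"
proof -
  have "k \<in> orbit kreweras i \<longleftrightarrow> \<not> (\<exists>p\<in>P. splits meets p {ColB, ColC})"
    using bounds by (intro orbit_kreweras_splits) auto
  moreover have "l \<in> orbit kreweras j \<longleftrightarrow> \<not> (\<exists>p\<in>P. splits meets p {ColC, ColD})"
    using bounds by (intro orbit_kreweras_splits) auto
  moreover have "j \<in> orbit kreweras i \<longleftrightarrow> \<not> (\<exists>p\<in>P. splits meets p {ColB})"
    using bounds by (intro orbit_kreweras_splits) auto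
  moreover have "l \<in> orbit kreweras k \<longleftrightarrow> \<not> (\<exists>p\<in>P. splits meets p {ColD})"
    using bounds by (intro orbit_kreweras_splits) auto
  moreover have "k \<in> orbit kreweras j \<longleftrightarrow> \<not> (\<exists>p\<in>P. splits meets p {ColC})"
    using bounds by (intro orbit_kreweras_splits) auto
  moreover have "l \<in> orbit kreweras i \<longleftrightarrow> \<not> (\<exists>p\<in>P. splits meets p {ColB, ColC, ColD})"
    using bounds by (intro orbit_kreweras_splits) auto
  ultimately show ?thesis unfolding genus_Phi_eq_1_iff by blast
qed

end

theorem theorem2p3:
  fixes n i j k l :: nat and P :: "nat set set"
  assumes "partition_on {1..n} P"
    and "noncrossing P"
    and "1 \<le> i" and "i < j" and "j \<le> k" and "k < l" and "l \<le> n"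
  shows "Phi n P i j k l permutes {1..n} \<and>
    (genus n (Phi n P i j k l) = 0 \<or> genus n (Phi n P i j k l) = 1) \<and>
    (genus n (Phi n P i j k l) = 1 \<longleftrightarrow>
      (\<exists>p\<in>P. card {X. p \<inter> color_class n i j k l X \<noteq> {}} \<ge> 3) \<or>
      (\<exists>p\<in>P. \<exists>q\<in>P. \<exists>X Y Z. p \<noteq> q \<and> X \<noteq> Y \<and> X \<noteq> Z \<and> Y \<noteq> Z \<and>
         p \<inter> color_class n i j k l X \<noteq> {} \<and> p \<inter> color_class n i j k l Y \<noteq> {} \<and>
         p \<subseteq> color_class n i j k l X \<union> color_class n i j k l Y \<and>
         q \<inter> color_class n i j k l X \<noteq> {} \<and> q \<inter> color_class n i j k l Z \<noteq> {} \<and>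
         q \<subseteq> color_class n i j k l X \<union> color_class n i j k l Z))"
proof -
  interpret colored_partition n P i j k l
    using assms by unfold_locales
  \<comment> \<open>This translates the avoided colors of \<open>split_colors_iff\<close> into the
    containments of the theorem.\<close>
  have sub: "(\<forall>W. W \<notin> {X, Y} \<longrightarrow> \<not> meets p W) \<longleftrightarrow> p \<subseteq> cls X \<union> cls Y" if "p \<in> P" for p X Y
    using subset_colors_iff[OF that, of "{X, Y}"] by simp
  have "genus n (Phi n P i j k l) = 1 \<longleftrightarrow>
      (\<exists>p\<in>P. card {X. meets p X} \<ge> 3) \<or>
      (\<exists>p\<in>P. \<exists>q\<in>P. \<exists>X Y Z. p \<noteq> q \<and> X \<noteq> Y \<and> X \<noteq> Z \<and> Y \<noteq> Z \<and>
         meets p X \<and> meets p Y \<and> p \<subseteq> cls X \<union> cls Y \<and>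
         meets q X \<and> meets q Z \<and> q \<subseteq> cls X \<union> cls Z)"
    unfolding genus_Phi_eq_1_iff_splits
    by (rule trans[OF split_colors_iff], rule meets_cross; (assumption)?)
      (intro arg_cong2[where f = "(\<or>)"] bex_cong ex_cong1 refl, simp only: sub)
  moreover have "genus n (Phi n P i j k l) = 0 \<or> genus n (Phi n P i j k l) = 1"
    by (simp add: genus_Phi)
  ultimately show ?thesis
    using Phi_permutes unfolding meets_def by (intro conjI)
qed

end
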